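(* There are only finitely many combinatorial types of supersolvable line arrangements $\mathcal{L}\subset\mathbb{P}^2_{\mathbb{C}}$ with $m(\mathcal{L})=4$.
   Context: We work over $\mathbb{C}$. A line arrangement $\mathcal{L}\subset\mathbb{P}^2$ is a finite set of distinct lines. For $r\ge 2$, $n_r$ denotes the number of points of $\mathbb{P}^2$ lying on exactly $r$ lines of $\mathcal{L}$, and the maximal multiplicity is $m(\mathcal{L})=\max\{r: n_r\neq 0\}$. An intersection point of $\mathcal{L}$ is a point lying on at least two lines of $\mathcal{L}$. An intersection point $p$ is modular if for every other intersection point $q$ of $\mathcal{L}$ the line joining $p$ and $q$ belongs to $\mathcal{L}$. The arrangement $\mathcal{L}$ is supersolvable if it admits a modular intersection point. Two line arrangements have the same combinatorial type if there are bijections between their sets of lines and between their sets of intersection points preserving incidence (equivalently, their intersection lattices are isomorphic). *)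

theory Defs
  imports "HOL-Analysis.Analysis"
begin

text \<open>
  The complex projective plane is the lattice of linear subspaces of \<open>complex ^ 3\<close>, taken over
  \<open>complex\<close>: the constants qualified with \<open>vec\<close> refer to the scalar multiplication
  \<open>(*s)\<close>. The unqualified \<open>subspace\<close>, \<open>span\<close>, \<open>dim\<close> would be those over the reals.
  Points and lines are subspaces of dimension 1 and 2, and incidence is inclusion.
\<close>

type_synonym arrangement = "(complex ^ 3) set set"

definition proj_point :: "(complex ^ 3) set \<Rightarrow> bool" where
  "proj_point p \<longleftrightarrow> vec.subspace p \<and> vec.dim p = 1"

definition proj_line :: "(complex ^ 3) set \<Rightarrow> bool" where
  "proj_line l \<longleftrightarrow> vec.subspace l \<and> vec.dim l = 2"

text \<open>For distinct points, this is the unique line through them.\<close>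

definition joining_line :: "(complex ^ 3) set \<Rightarrow> (complex ^ 3) set \<Rightarrow> (complex ^ 3) set" where
  "joining_line p q = vec.span (p \<union> q)"

definition line_arrangement :: "arrangement \<Rightarrow> bool" where
  "line_arrangement A \<longleftrightarrow> finite A \<and> (\<forall>l\<in>A. proj_line l)"

definition mult_at :: "arrangement \<Rightarrow> (complex ^ 3) set \<Rightarrow> nat" where
  "mult_at A p = card {l \<in> A. p \<subseteq> l}"

definition n_points :: "arrangement \<Rightarrow> nat \<Rightarrow> nat" where
  "n_points A r = card {p. proj_point p \<and> mult_at A p = r}"

text \<open>
  Only meaningful for arrangements with at least one intersection point; otherwise the set below
  is empty and the value is unspecified.
\<close>

definition max_mult :: "arrangement \<Rightarrow> nat" where
  "max_mult A = Max {r. 2 \<le> r \<and> n_points A r \<noteq> 0}"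

definition intersection_points :: "arrangement \<Rightarrow> (complex ^ 3) set set" where
  "intersection_points A = {p. proj_point p \<and> 2 \<le> mult_at A p}"

definition modular_point :: "arrangement \<Rightarrow> (complex ^ 3) set \<Rightarrow> bool" where
  "modular_point A p \<longleftrightarrow>
     p \<in> intersection_points A \<and>
     (\<forall>q\<in>intersection_points A. q \<noteq> p \<longrightarrow> joining_line p q \<in> A)"

definition supersolvable :: "arrangement \<Rightarrow> bool" where
  "supersolvable A \<longleftrightarrow> (\<exists>p. modular_point A p)"

definition same_combinatorial_type :: "arrangement \<Rightarrow> arrangement \<Rightarrow> bool" where
  "same_combinatorial_type A B \<longleftrightarrow>
     (\<exists>f g. bij_betw f A B \<and>
            bij_betw g (intersection_points A) (intersection_points B) \<and>
            (\<forall>l\<in>A. \<forall>p\<in>intersection_points A. p \<subseteq> l \<longleftrightarrow> g p \<subseteq> f l))"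

definition combinatorial_type_rel :: "arrangement set \<Rightarrow> (arrangement \<times> arrangement) set" where
  "combinatorial_type_rel S = {(A, B). A \<in> S \<and> B \<in> S \<and> same_combinatorial_type A B}"

definition combinatorial_types :: "arrangement set \<Rightarrow> arrangement set set" where
  "combinatorial_types S = S // combinatorial_type_rel S"

lemma same_combinatorial_typeI:
  assumes "bij_betw f A B"
    and "bij_betw g (intersection_points A) (intersection_points B)"
    and "\<And>l p. l \<in> A \<Longrightarrow> p \<in> intersection_points A \<Longrightarrow> p \<subseteq> l \<longleftrightarrow> g p \<subseteq> f l"
  shows "same_combinatorial_type A B"
  unfolding same_combinatorial_type_def
  by (rule exI[of _ f], rule exI[of _ g], intro conjI ballI) (rule assms; assumption)+

lemma same_combinatorial_typeE:
  assumes "same_combinatorial_type A B"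
  obtains f g where "bij_betw f A B"
    and "bij_betw g (intersection_points A) (intersection_points B)"
    and "\<And>l p. l \<in> A \<Longrightarrow> p \<in> intersection_points A \<Longrightarrow> p \<subseteq> l \<longleftrightarrow> g p \<subseteq> f l"
proof -
  from assms[unfolded same_combinatorial_type_def] show thesis
  proof (elim exE conjE)
    fix f g
    assume "bij_betw f A B"
      and "bij_betw g (intersection_points A) (intersection_points B)"
      and inc: "\<forall>l\<in>A. \<forall>p\<in>intersection_points A. p \<subseteq> l \<longleftrightarrow> g p \<subseteq> f l"
    then show thesis
      by (intro that[of f g]) (assumption | rule inc[THEN bspec, THEN bspec])+
  qed
qed

lemma same_combinatorial_type_refl: "same_combinatorial_type A A"
  by (rule same_combinatorial_typeI[of id _ _ id]) simp_all

lemma same_combinatorial_type_sym: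
  assumes "same_combinatorial_type A B"
  shows "same_combinatorial_type B A"
  using assms
proof (rule same_combinatorial_typeE)
  fix f g
  assume f: "bij_betw f A B"
    and g: "bij_betw g (intersection_points A) (intersection_points B)"
    and inc: "\<And>l p. l \<in> A \<Longrightarrow> p \<in> intersection_points A \<Longrightarrow> p \<subseteq> l \<longleftrightarrow> g p \<subseteq> f l"
  let ?f = "inv_into A f" and ?g = "inv_into (intersection_points A) g"
  show ?thesis
  proof (rule same_combinatorial_typeI)
    show "bij_betw ?f B A"
      by (rule bij_betw_inv_into[OF f])
    show "bij_betw ?g (intersection_points B) (intersection_points A)"
      by (rule bij_betw_inv_into[OF g])
    fix l p assume l: "l \<in> B" and p: "p \<in> intersection_points B"
    have "?g p \<subseteq> ?f l \<longleftrightarrow> g (?g p) \<subseteq> f (?f l)"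
      by (rule inc[OF bij_betw_apply[OF bij_betw_inv_into[OF f] l]
            bij_betw_apply[OF bij_betw_inv_into[OF g] p]])
    then show "p \<subseteq> l \<longleftrightarrow> ?g p \<subseteq> ?f l"
      by (simp only: bij_betw_inv_into_right[OF f l] bij_betw_inv_into_right[OF g p])
  qed
qed

lemma same_combinatorial_type_trans:
  assumes "same_combinatorial_type A B" "same_combinatorial_type B C"
  shows "same_combinatorial_type A C"
  using assms(1)
proof (rule same_combinatorial_typeE)
  fix f g
  assume f: "bij_betw f A B"
    and g: "bij_betw g (intersection_points A) (intersection_points B)"
    and inc: "\<And>l p. l \<in> A \<Longrightarrow> p \<in> intersection_points A \<Longrightarrow> p \<subseteq> l \<longleftrightarrow> g p \<subseteq> f l"
  from assms(2) show ?thesis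
  proof (rule same_combinatorial_typeE)
    fix f' g'
    assume f': "bij_betw f' B C"
      and g': "bij_betw g' (intersection_points B) (intersection_points C)"
      and inc': "\<And>l p. l \<in> B \<Longrightarrow> p \<in> intersection_points B \<Longrightarrow> p \<subseteq> l \<longleftrightarrow> g' p \<subseteq> f' l"
    show ?thesis
    proof (rule same_combinatorial_typeI)
      show "bij_betw (f' \<circ> f) A C"
        by (rule bij_betw_trans[OF f f'])
      show "bij_betw (g' \<circ> g) (intersection_points A) (intersection_points C)"
        by (rule bij_betw_trans[OF g g'])
      fix l p assume l: "l \<in> A" and p: "p \<in> intersection_points A"
      show "p \<subseteq> l \<longleftrightarrow> (g' \<circ> g) p \<subseteq> (f' \<circ> f) l"
        by (simp only: comp_apply inc[OF l p]
            inc'[OF bij_betw_apply[OF f l] bij_betw_apply[OF g p]])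
    qed
  qed
qed

lemma equiv_combinatorial_type_rel: "equiv S (combinatorial_type_rel S)"
proof (rule equivI)
  show "combinatorial_type_rel S \<subseteq> S \<times> S"
    unfolding combinatorial_type_rel_def by blast
  show "refl_on S (combinatorial_type_rel S)"
    using same_combinatorial_type_refl unfolding combinatorial_type_rel_def refl_on_def by blast
  show "sym (combinatorial_type_rel S)"
    using same_combinatorial_type_sym unfolding combinatorial_type_rel_def sym_def by blast
  show "trans (combinatorial_type_rel S)"
    using same_combinatorial_type_trans unfolding combinatorial_type_rel_def trans_def by blast
qed

end

theory Submission
  imports Defs
begin

text \<open>
  Supersolvability bounds the number of lines quadratically in the maximal multiplicity \<open>m\<close>. Let
  \<open>p\<close> be a modular point; at most \<open>m\<close> lines pass through it, so suppose that some line \<open>l0\<close> of the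
  arrangement misses \<open>p\<close>. Any other line \<open>l\<close> meets \<open>l0\<close> in an intersection point \<open>q \<noteq> p\<close>, and by
  modularity \<open>q\<close> lies on one of the lines through \<open>p\<close>. Hence there are at most \<open>m\<close> possibilities
  for \<open>q\<close> on \<open>l0\<close>, and each of them carries at most \<open>m\<close> lines: the arrangement has at most
  \<open>m\<^sup>2\<close> lines (lemma \<open>card_supersolvable_le\<close>), that is, at most sixteen for \<open>m = 4\<close>.

  Arrangements with a bounded number of lines have only finitely many combinatorial types (lemma
  \<open>finite_combinatorial_types_if_bounded\<close>). After numbering the lines, an intersection point is
  determined by the set of numbers of the lines through it, so the combinatorial type is
  determined by a family of subsets of a finite set of numbers.
\<close>

section \<open>Intersections of lines in the projective plane\<close>

lemma proj_point_Int_lines: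
  assumes l: "proj_line l" and l': "proj_line l'" and neq: "l \<noteq> l'"
  shows "proj_point (l \<inter> l')"
proof -
  have sub: "vec.subspace l" "vec.subspace l'" "vec.subspace (l \<inter> l')"
    and dim2: "vec.dim l = 2" "vec.dim l' = 2"
    using l l' by (auto simp: proj_line_def vec.subspace_inter)
  have "vec.dim {x + y |x y. x \<in> l \<and> y \<in> l'} + vec.dim (l \<inter> l') = 4"
    using vec.dim_sums_Int[OF sub(1,2)] dim2 by simp
  moreover have "vec.dim {x + y |x y. x \<in> l \<and> y \<in> l'} \<le> 3"
    using dim_subset_UNIV_cart_gen[of "{x + y |x y. x \<in> l \<and> y \<in> l'}"] by simp
  ultimately have ge: "vec.dim (l \<inter> l') \<ge> 1" by linarith
  have "vec.dim (l \<inter> l') < 2"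
  proof (rule ccontr)
    assume "\<not> vec.dim (l \<inter> l') < 2"
    then have dim: "vec.dim l \<le> vec.dim (l \<inter> l')" "vec.dim l' \<le> vec.dim (l \<inter> l')"
      using dim2 by simp_all
    have "l \<inter> l' = l" by (rule vec.subspace_dim_equal[OF sub(3,1) Int_lower1 dim(1)])
    moreover have "l \<inter> l' = l'" by (rule vec.subspace_dim_equal[OF sub(3,2) Int_lower2 dim(2)])
    ultimately show False using neq by simp
  qed
  with ge sub(3) show ?thesis by (simp add: proj_point_def)
qed

lemma proj_point_eq_if_subset: "proj_point p \<Longrightarrow> proj_point q \<Longrightarrow> p \<subseteq> q \<Longrightarrow> p = q"
  unfolding proj_point_def by (rule vec.subspace_dim_equal) auto

lemma proj_point_eq_Int_lines:
  assumes "proj_line l" "proj_line l'" "l \<noteq> l'" "proj_point p" "p \<subseteq> l" "p \<subseteq> l'"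
  shows "p = l \<inter> l'"
  by (rule proj_point_eq_if_subset[OF assms(4) proj_point_Int_lines[OF assms(1-3)]
        Int_greatest[OF assms(5,6)]])

lemma two_lines_through_intersection_point:
  assumes "p \<in> intersection_points A"
  obtains l l' where "l \<in> A" "l' \<in> A" "l \<noteq> l'" "p \<subseteq> l" "p \<subseteq> l'"
proof -
  have "2 \<le> card {l \<in> A. p \<subseteq> l}"
    using assms by (simp add: intersection_points_def mult_at_def)
  then obtain T where T: "T \<subseteq> {l \<in> A. p \<subseteq> l}" "card T = 2"
    by (rule obtain_subset_with_card_n)
  from T(2) obtain l l' where "T = {l, l'}" "l \<noteq> l'" unfolding card_2_iff by blast
  with T(1) show thesis by (intro that[of l l']) auto
qed

lemma inj_on_lines_through:
  assumes A: "line_arrangement A"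
  shows "inj_on (\<lambda>p. {l \<in> A. p \<subseteq> l}) (intersection_points A)"
proof (rule inj_onI)
  fix p q
  assume p: "p \<in> intersection_points A" and q: "q \<in> intersection_points A"
    and eq: "{l \<in> A. p \<subseteq> l} = {l \<in> A. q \<subseteq> l}"
  obtain l l' where l: "l \<in> A" "l' \<in> A" "l \<noteq> l'" "p \<subseteq> l" "p \<subseteq> l'"
    using two_lines_through_intersection_point[OF p] .
  have q': "q \<subseteq> l" "q \<subseteq> l'" using l eq by blast+
  have lines: "proj_line l" "proj_line l'" using A l by (simp_all add: line_arrangement_def)
  have pts: "proj_point p" "proj_point q" using p q by (simp_all add: intersection_points_def)
  show "p = q"
    using proj_point_eq_Int_lines[OF lines l(3) pts(1) l(4,5)]
      proj_point_eq_Int_lines[OF lines l(3) pts(2) q'] by (rule trans[OF _ sym])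
qed

lemma finite_intersection_points:
  assumes "line_arrangement A"
  shows "finite (intersection_points A)"
proof (rule inj_on_finite[OF inj_on_lines_through[OF assms]])
  show "(\<lambda>p. {l \<in> A. p \<subseteq> l}) ` intersection_points A \<subseteq> Pow A" by blast
  show "finite (Pow A)" using assms by (simp add: line_arrangement_def)
qed

section \<open>Supersolvable arrangements have at most quadratically many lines\<close>

lemma mult_at_le_max_mult:
  assumes A: "line_arrangement A" and p: "p \<in> intersection_points A"
  shows "mult_at A p \<le> max_mult A"
proof -
  let ?P = "{q. proj_point q \<and> mult_at A q = mult_at A p}"
  have p': "proj_point p" "2 \<le> mult_at A p"
    using p by (auto simp: intersection_points_def)
  have "?P \<subseteq> intersection_points A"
    using p'(2) by (auto simp: intersection_points_def)
  then have "finite ?P"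
    using finite_intersection_points[OF A] by (rule finite_subset)
  then have "n_points A (mult_at A p) \<noteq> 0"
    using p'(1) by (auto simp: n_points_def)
  moreover have "r \<le> card A" if "n_points A r \<noteq> 0" for r
  proof -
    from that obtain q where "mult_at A q = r"
      unfolding n_points_def by (auto simp: card_eq_0_iff)
    then show ?thesis
      using A by (auto simp: mult_at_def line_arrangement_def intro: card_mono)
  qed
  then have "finite {r. 2 \<le> r \<and> n_points A r \<noteq> 0}"
    by (auto intro: finite_subset[OF _ finite_atMost[of "card A"]])
  ultimately show ?thesis
    using p'(2) unfolding max_mult_def by (intro Max_ge) auto
qed

text \<open>
  A line \<open>l\<close> different from \<open>l0\<close> meets \<open>l0\<close> in an intersection point \<open>q\<close>, and the line \<open>h\<close>
  joining the modular point to \<open>q\<close> meets \<open>l0\<close> in the same point. The line \<open>l0\<close> itself is covered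
  as well, because some line passes through the modular point.
\<close>

lemma lines_covered_from_modular_point:
  assumes A: "line_arrangement A" and p: "modular_point A p"
    and l0: "l0 \<in> A" "\<not> p \<subseteq> l0"
  shows "A \<subseteq> (\<Union>h\<in>{h \<in> A. p \<subseteq> h}. {l \<in> A. h \<inter> l0 \<subseteq> l})"
proof
  fix l assume l: "l \<in> A"
  have lines: "proj_line k" if "k \<in> A" for k
    using A that by (simp add: line_arrangement_def)
  have pI: "p \<in> intersection_points A" using p by (simp add: modular_point_def)
  have "\<exists>h\<in>A. p \<subseteq> h \<and> h \<inter> l0 \<subseteq> l"
  proof (cases "l = l0")
    case True
    obtain h where "h \<in> A" "p \<subseteq> h"
      by (rule two_lines_through_intersection_point[OF pI])
    with True show ?thesis by auto
  next
    case False
    let ?q = "l \<inter> l0"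
    have q: "proj_point ?q"
      by (rule proj_point_Int_lines[OF lines[OF l] lines[OF l0(1)] False])
    have "card {l, l0} \<le> mult_at A ?q"
      unfolding mult_at_def using A l l0 by (intro card_mono) (auto simp: line_arrangement_def)
    then have "?q \<in> intersection_points A"
      using q False by (simp add: intersection_points_def)
    moreover have "?q \<noteq> p" using l0 by blast
    ultimately have h: "joining_line p ?q \<in> A"
      using p by (auto simp: modular_point_def)
    have "p \<union> ?q \<subseteq> joining_line p ?q"
      unfolding joining_line_def by (rule vec.span_superset)
    then have incident: "p \<subseteq> joining_line p ?q" "?q \<subseteq> joining_line p ?q"
      by (simp_all only: Un_subset_iff)
    have "joining_line p ?q \<noteq> l0" using incident(1) l0(2) by metis
    then have "?q = joining_line p ?q \<inter> l0"
      using proj_point_eq_Int_lines[OF lines[OF h] lines[OF l0(1)] _ q incident(2)] by simp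
    then show ?thesis using h incident by blast
  qed
  then show "l \<in> (\<Union>h\<in>{h \<in> A. p \<subseteq> h}. {l \<in> A. h \<inter> l0 \<subseteq> l})" using l by blast
qed

lemma card_supersolvable_le:
  assumes A: "line_arrangement A" and ss: "supersolvable A"
  shows "card A \<le> (max_mult A)\<^sup>2"
proof -
  obtain p where p: "modular_point A p" using ss by (auto simp: supersolvable_def)
  let ?H = "{h \<in> A. p \<subseteq> h}" and ?m = "max_mult A"
  have fin: "finite A" using A by (simp add: line_arrangement_def)
  have pI: "p \<in> intersection_points A" using p by (simp add: modular_point_def)
  have cardH: "card ?H \<le> ?m"
    using mult_at_le_max_mult[OF A pI] by (simp add: mult_at_def)
  show ?thesis
  proof (cases "A = ?H")
    case True
    \<comment> \<open>A pencil: all lines pass through the modular point.\<close>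
    then have "card A \<le> ?m" using cardH by simp
    also have "?m \<le> ?m\<^sup>2" by (simp add: power2_eq_square)
    finally show ?thesis .
  next
    case False
    then obtain l0 where l0: "l0 \<in> A" "\<not> p \<subseteq> l0" by blast
    have through: "card {l \<in> A. h \<inter> l0 \<subseteq> l} \<le> ?m" if "h \<in> ?H" for h
    proof -
      have "h \<noteq> l0" "h \<in> A" using that l0 by auto
      then have pt: "proj_point (h \<inter> l0)"
        using A l0 by (simp add: proj_point_Int_lines line_arrangement_def)
      have "card {h, l0} \<le> mult_at A (h \<inter> l0)"
        unfolding mult_at_def using fin \<open>h \<in> A\<close> l0 by (intro card_mono) auto
      then have "h \<inter> l0 \<in> intersection_points A"
        using pt \<open>h \<noteq> l0\<close> by (simp add: intersection_points_def)
      from mult_at_le_max_mult[OF A this] show ?thesis by (simp add: mult_at_def)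
    qed
    have "card A \<le> card (\<Union>h\<in>?H. {l \<in> A. h \<inter> l0 \<subseteq> l})"
      using lines_covered_from_modular_point[OF A p l0] fin by (intro card_mono) auto
    also have "\<dots> \<le> (\<Sum>h\<in>?H. card {l \<in> A. h \<inter> l0 \<subseteq> l})"
      using fin by (intro card_UN_le) simp
    also have "\<dots> \<le> card ?H * ?m"
      using sum_bounded_above[of ?H "\<lambda>h. card {l \<in> A. h \<inter> l0 \<subseteq> l}" ?m] through by simp
    also have "\<dots> \<le> ?m\<^sup>2"
      using cardH by (simp add: power2_eq_square)
    finally show ?thesis .
  qed
qed

section \<open>Boundedly many lines give finitely many combinatorial types\<close>

definition line_numbering :: "arrangement \<Rightarrow> (complex ^ 3) set \<Rightarrow> nat" where
  "line_numbering A = (SOME e. bij_betw e A {..<card A})"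

definition line_numbers_at :: "arrangement \<Rightarrow> (complex ^ 3) set \<Rightarrow> nat set" where
  "line_numbers_at A p = line_numbering A ` {l \<in> A. p \<subseteq> l}"

definition incidence_code :: "arrangement \<Rightarrow> nat \<times> nat set set" where
  "incidence_code A = (card A, line_numbers_at A ` intersection_points A)"

lemma bij_betw_line_numbering:
  assumes "line_arrangement A"
  shows "bij_betw (line_numbering A) A {..<card A}"
proof -
  have "\<exists>e. bij_betw e A {..<card A}"
    using assms ex_bij_betw_finite_nat[of A]
    by (auto simp: line_arrangement_def atLeast0LessThan)
  then show ?thesis unfolding line_numbering_def by (rule someI_ex)
qed

lemma line_number_mem_iff:
  assumes "line_arrangement A" "l \<in> A"
  shows "line_numbering A l \<in> line_numbers_at A p \<longleftrightarrow> p \<subseteq> l"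
proof -
  have "inj_on (line_numbering A) A"
    using bij_betw_line_numbering[OF assms(1)] by (rule bij_betw_imp_inj_on)
  then show ?thesis using assms(2) by (auto simp: line_numbers_at_def dest: inj_onD)
qed

lemma bij_betw_line_numbers_at:
  assumes A: "line_arrangement A"
  shows "bij_betw (line_numbers_at A) (intersection_points A) (snd (incidence_code A))"
proof -
  have "inj_on (line_numbers_at A) (intersection_points A)"
  proof (rule inj_onI)
    fix p q
    assume pq: "p \<in> intersection_points A" "q \<in> intersection_points A"
      and eq: "line_numbers_at A p = line_numbers_at A q"
    have "{l \<in> A. p \<subseteq> l} = {l \<in> A. q \<subseteq> l}"
      using eq line_number_mem_iff[OF A] by blast
    then show "p = q" using inj_on_lines_through[OF A] pq by (auto dest: inj_onD)
  qed
  then show ?thesis by (simp add: bij_betw_def incidence_code_def)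
qed

text \<open>
  Lines correspond if they have the same number, and points correspond if the same numbers occur
  at them; incidence is membership of the number of the line among those of the point.
\<close>

lemma same_combinatorial_type_if_incidence_code_eq:
  assumes A: "line_arrangement A" and B: "line_arrangement B"
    and code: "incidence_code A = incidence_code B"
  shows "same_combinatorial_type A B"
proof -
  let ?f = "inv_into B (line_numbering B) \<circ> line_numbering A"
  let ?g = "inv_into (intersection_points B) (line_numbers_at B) \<circ> line_numbers_at A"
  have card: "card A = card B" using code by (simp add: incidence_code_def)
  note numA = bij_betw_line_numbering[OF A, unfolded card]
    and numB = bij_betw_line_numbering[OF B]
  note ptA = bij_betw_line_numbers_at[OF A, unfolded code]
    and ptB = bij_betw_line_numbers_at[OF B]
  have f: "bij_betw ?f A B"
    by (rule bij_betw_trans[OF numA bij_betw_inv_into[OF numB]])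
  have g: "bij_betw ?g (intersection_points A) (intersection_points B)"
    by (rule bij_betw_trans[OF ptA bij_betw_inv_into[OF ptB]])
  show ?thesis
  proof (rule same_combinatorial_typeI[OF f g])
    fix l p
    assume l: "l \<in> A" and p: "p \<in> intersection_points A"
    have fl: "line_numbering B (?f l) = line_numbering A l"
      using bij_betw_inv_into_right[OF numB bij_betw_apply[OF numA l]] by simp
    have gp: "line_numbers_at B (?g p) = line_numbers_at A p"
      using bij_betw_inv_into_right[OF ptB bij_betw_apply[OF ptA p]] by simp
    have "p \<subseteq> l \<longleftrightarrow> line_numbering A l \<in> line_numbers_at A p"
      using line_number_mem_iff[OF A l] by simp
    also have "\<dots> \<longleftrightarrow> line_numbering B (?f l) \<in> line_numbers_at B (?g p)"
      unfolding fl gp ..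
    also have "\<dots> \<longleftrightarrow> ?g p \<subseteq> ?f l"
      by (rule line_number_mem_iff[OF B bij_betw_apply[OF f l]])
    finally show "p \<subseteq> l \<longleftrightarrow> ?g p \<subseteq> ?f l" .
  qed
qed

lemma incidence_code_bounded:
  assumes A: "line_arrangement A" and N: "card A \<le> N"
  shows "incidence_code A \<in> {..N} \<times> Pow (Pow {..<N})"
proof -
  have "line_numbering A l < N" if "l \<in> A" for l
    using bij_betw_apply[OF bij_betw_line_numbering[OF A] that] N by simp
  then show ?thesis using N by (auto simp: incidence_code_def line_numbers_at_def)
qed

lemma finite_combinatorial_types_if_bounded:
  assumes arr: "\<And>A. A \<in> S \<Longrightarrow> line_arrangement A"
    and bound: "\<And>A. A \<in> S \<Longrightarrow> card A \<le> N"
  shows "finite (combinatorial_types S)"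
proof -
  let ?r = "combinatorial_type_rel S"
  \<comment> \<open>The class of an arrangement depends only on its code: it is the class of any arrangement
    with that code.\<close>
  let ?class = "\<lambda>c. ?r `` {A \<in> S. incidence_code A = c}"
  have "finite (incidence_code ` S)"
  proof (rule finite_subset)
    show "incidence_code ` S \<subseteq> {..N} \<times> Pow (Pow {..<N})"
      using incidence_code_bounded[OF arr bound] by blast
  qed simp
  then have "finite (?class ` incidence_code ` S)" by (rule finite_imageI)
  moreover have "combinatorial_types S \<subseteq> ?class ` incidence_code ` S"
  proof
    fix X assume "X \<in> combinatorial_types S"
    then obtain A where A: "A \<in> S" "X = ?r `` {A}"
      unfolding combinatorial_types_def by (rule quotientE)
    have "?r `` {B} = ?r `` {A}" if "B \<in> S" "incidence_code B = incidence_code A" for B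
    proof (rule equiv_class_eq[OF equiv_combinatorial_type_rel])
      show "(B, A) \<in> ?r"
        using that A(1) arr
        by (auto simp: combinatorial_type_rel_def
            intro: same_combinatorial_type_if_incidence_code_eq)
    qed
    then have "?class (incidence_code A) = X" using A by blast
    then show "X \<in> ?class ` incidence_code ` S" using A(1) by blast
  qed
  ultimately show ?thesis by (rule rev_finite_subset)
qed

theorem corollary3p6:
  "finite (combinatorial_types
     {A. line_arrangement A \<and> supersolvable A \<and> max_mult A = 4})"
proof (rule finite_combinatorial_types_if_bounded)
  fix A :: arrangement
  assume "A \<in> {A. line_arrangement A \<and> supersolvable A \<and> max_mult A = 4}"
  then show "line_arrangement A" and "card A \<le> 4\<^sup>2"
    using card_supersolvable_le[of A] by auto
qed

end
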